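(* Let $F:\mathbb{F}_{2^n}\to\mathbb{F}_{2^n}$ be a function. The set $S=\{(x,F(x)) : x\in\mathbb{F}_{2^n}\}\subset\mathbb{F}_{2^n}^2$ is formally self dual under the trace pairing if and only if $2^n\delta_F(a,b)=(W_F(a,b))^2$ for all $a,b\in\mathbb{F}_{2^n}$.
   Context: $\mathrm{Tr}:\mathbb{F}_{2^n}\to\mathbb{F}_2$ is the absolute trace $x\mapsto x+x^2+\dots+x^{2^{n-1}}$. $\delta_F(a,b)=|\{x\in\mathbb{F}_{2^n}:F(x+a)+F(x)=b\}|$ and $W_F(a,b)=\sum_{x\in\mathbb{F}_{2^n}}(-1)^{\mathrm{Tr}(bF(x)+ax)}$. Let $G=\mathbb{F}_{2^n}^2$ (additive group) and $\Delta:G\to\hat G$ the isomorphism given by the trace pairing $\langle (x,y),(a,b)\rangle=(-1)^{\mathrm{Tr}(ax+by)}$, i.e. $[\Delta(a,b)](x,y)=(-1)^{\mathrm{Tr}(ax+by)}$. $S\subset G$ is formally self dual under the trace pairing if $S$ and $\Delta(S)$ form a formally dual pair, meaning $|\chi(S)|^2=\frac{|S|^2}{|\Delta(S)|}\nu_{\Delta(S)}(\chi)$ for all $\chi\in\hat G$ with $\chi(S)=\sum_{s\in S}\chi(s)$, $\nu_T(\chi)=|\{(\phi,\psi)\in T^2:\phi\psi^{-1}=\chi\}|$; equivalently, for all $(a,b)\in G$: $\big(\sum_{(x,y)\in S}(-1)^{\mathrm{Tr}(ax+by)}\big)^2=|S|\cdot|\{(s,t)\in S^2:s-t=(a,b)\}|$.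 *)

theory Defs
  imports Complex_Main "HOL-Library.Cardinality" "HOL-Library.Product_Plus"
begin

definition abs_trace :: "nat \<Rightarrow> 'a::comm_semiring_1 \<Rightarrow> 'a" where
  "abs_trace n x = (\<Sum>i<n. x ^ (2 ^ i))"

text \<open>The prime field of a field with \<open>2 ^ n\<close> elements is represented by the subset
  \<open>{0, 1}\<close> of the field itself; the trace takes values there.\<close>

lemma add_self_eq_0_of_card:
  fixes x :: "'a::{field,finite}"
  assumes "CARD('a) = 2 ^ n"
  shows "x + x = 0"
proof -
  have "(\<Sum>y\<in>(UNIV::'a set). y) = (\<Sum>y\<in>(UNIV::'a set). y + 1)"
    by (rule sum.reindex_bij_witness[where i = "\<lambda>y. y + 1" and j = "\<lambda>y. y - 1"]) auto
  also have "\<dots> = (\<Sum>y\<in>(UNIV::'a set). y) + of_nat CARD('a)"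
    by (simp add: sum.distrib)
  finally have "(2::'a) ^ n = 0"
    using assms by simp
  then have "(2::'a) = 0"
    by simp
  then show ?thesis
    by (metis mult_2 mult_zero_left)
qed

lemma power_card_eq_self:
  fixes x :: "'a::{field,finite}"
  shows "x ^ CARD('a) = x"
proof (cases "x = 0")
  case True
  then show ?thesis by (simp add: power_0_left)
next
  case False
  let ?U = "UNIV - {0::'a}"
  have "(\<Prod>y\<in>?U. y) = (\<Prod>y\<in>?U. x * y)"
    using False
    by (intro prod.reindex_bij_witness[where i = "\<lambda>y. x * y" and j = "\<lambda>y. y / x"]) auto
  also have "\<dots> = x ^ card ?U * (\<Prod>y\<in>?U. y)"
    by (simp add: prod.distrib)
  finally have "x ^ card ?U = 1"
    by simp
  moreover have "CARD('a) = Suc (card ?U)"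
    by (simp add: card_Suc_Diff1)
  ultimately show ?thesis
    by (metis mult.right_neutral power_Suc)
qed

lemma abs_trace_in_prime_field:
  fixes x :: "'a::{field,finite}"
  assumes card: "CARD('a) = 2 ^ n"
  shows "abs_trace n x \<in> {0, 1}"
proof -
  have sq_add: "(u + v)\<^sup>2 = u\<^sup>2 + v\<^sup>2" for u v :: 'a
  proof -
    have "(u + v)\<^sup>2 = u\<^sup>2 + v\<^sup>2 + (u * v + u * v)"
      by (simp add: power2_eq_square algebra_simps)
    then show ?thesis
      by (simp add: add_self_eq_0_of_card[OF card])
  qed
  have "(abs_trace m x)\<^sup>2 + x = abs_trace m x + x ^ (2 ^ m)" for m
  proof (induction m)
    case 0
    show ?case by (simp add: abs_trace_def)
  next
    case (Suc m)
    have "(abs_trace (Suc m) x)\<^sup>2 + x = ((abs_trace m x)\<^sup>2 + x) + x ^ (2 ^ Suc m)"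
      by (simp add: abs_trace_def sq_add algebra_simps flip: power_mult)
    also have "\<dots> = abs_trace (Suc m) x + x ^ (2 ^ Suc m)"
      by (simp only: Suc.IH) (simp add: abs_trace_def)
    finally show ?case .
  qed
  from this[of n] have "(abs_trace n x)\<^sup>2 = abs_trace n x"
    using power_card_eq_self[of x] by (simp add: card)
  then show ?thesis
    by (simp add: power2_eq_square)
qed

text \<open>\<open>(-1)\<^sup>u\<close> for \<open>u\<close> in the prime field; only meaningful on \<open>{0, 1}\<close>.\<close>

definition minus_one_pow :: "'a::zero \<Rightarrow> int" where
  "minus_one_pow u = (if u = 0 then 1 else -1)"

definition diff_count :: "('a::ab_group_add \<Rightarrow> 'a) \<Rightarrow> 'a \<Rightarrow> 'a \<Rightarrow> nat" where
  "diff_count F a b = card {x. F (x + a) + F x = b}"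

definition walsh :: "nat \<Rightarrow> ('a::{field,finite} \<Rightarrow> 'a) \<Rightarrow> 'a \<Rightarrow> 'a \<Rightarrow> int" where
  "walsh n F a b = (\<Sum>x\<in>UNIV. minus_one_pow (abs_trace n (b * F x + a * x)))"

text \<open>Homomorphisms from a finite abelian group to the nonzero complex numbers. The group
  operation of the dual group is pointwise multiplication.\<close>

definition dual_group :: "('g::{ab_group_add,finite} \<Rightarrow> complex) set" where
  "dual_group = {\<chi>. (\<forall>x. \<chi> x \<noteq> 0) \<and> (\<forall>x y. \<chi> (x + y) = \<chi> x * \<chi> y)}"

definition char_sum :: "('g \<Rightarrow> complex) \<Rightarrow> 'g set \<Rightarrow> complex" where
  "char_sum \<chi> S = (\<Sum>s\<in>S. \<chi> s)"

definition char_weight :: "('g \<Rightarrow> complex) set \<Rightarrow> ('g \<Rightarrow> complex) \<Rightarrow> nat" where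
  "char_weight T \<chi> =
     card {(\<phi>, \<psi>). \<phi> \<in> T \<and> \<psi> \<in> T \<and> (\<lambda>g. \<phi> g * inverse (\<psi> g)) = \<chi>}"

definition formally_dual_pair ::
    "'g::{ab_group_add,finite} set \<Rightarrow> ('g \<Rightarrow> complex) set \<Rightarrow> bool" where
  "formally_dual_pair S T \<longleftrightarrow> T \<subseteq> dual_group \<and>
     (\<forall>\<chi>\<in>dual_group.
        (cmod (char_sum \<chi> S))\<^sup>2 = (real (card S))\<^sup>2 / real (card T) * real (char_weight T \<chi>))"

definition formally_self_dual ::
    "('g::{ab_group_add,finite} \<Rightarrow> 'g \<Rightarrow> complex) \<Rightarrow> 'g set \<Rightarrow> bool" where
  "formally_self_dual \<Delta> S \<longleftrightarrow> formally_dual_pair S (\<Delta> ` S)"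

definition trace_pairing :: "nat \<Rightarrow> 'a::field \<times> 'a \<Rightarrow> 'a \<times> 'a \<Rightarrow> complex" where
  "trace_pairing n = (\<lambda>(a, b) (x, y). of_int (minus_one_pow (abs_trace n (a * x + b * y))))"

end

theory Submission
  imports Defs "HOL-Computational_Algebra.Polynomial"
begin

text \<open>
  The trace pairing is a non-degenerate symmetric bicharacter of \<open>G\<close>, and by orthogonality of
  characters \<open>\<Delta>\<close> is an isomorphism from \<open>G\<close> onto its dual. Hence formal self-duality of the
  graph of \<open>F\<close> can be tested on the characters \<open>\<Delta>(a, b)\<close> only. There the character sum is
  \<open>W\<^sub>F(a, b)\<close>, and the weight of \<open>\<Delta>(a, b)\<close> counts the differences \<open>(a, b)\<close> of two points of the
  graph, which is \<open>\<delta>\<^sub>F(a, b)\<close> as \<open>-1 = 1\<close>.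
\<close>

section \<open>Characters of a finite abelian group\<close>

lemma sum_dual_group_eq_0:
  assumes "\<chi> \<in> dual_group" and "\<chi> \<noteq> (\<lambda>_. 1)"
  shows "(\<Sum>x\<in>UNIV. \<chi> x) = 0"
proof -
  obtain y where y: "\<chi> y \<noteq> 1"
    using assms(2) by auto
  \<comment> \<open>Translation by \<open>y\<close> permutes the group and scales the sum by
    \<open>\<chi> y\<close>, which is not 1.\<close>
  have "(\<Sum>x\<in>UNIV. \<chi> x) = (\<Sum>x\<in>UNIV. \<chi> (y + x))"
    by (rule sum.reindex_bij_witness[where i = "\<lambda>x. y + x" and j = "\<lambda>x. x - y"]) auto
  also have "\<dots> = \<chi> y * (\<Sum>x\<in>UNIV. \<chi> x)"
    using assms(1) by (simp add: dual_group_def sum_distrib_left)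
  finally show ?thesis
    using y by simp
qed

lemma dual_group_0:
  assumes "\<chi> \<in> dual_group"
  shows "\<chi> 0 = 1"
proof -
  have "\<chi> (0 + 0) = \<chi> 0 * \<chi> 0" "\<chi> 0 \<noteq> 0"
    using assms by (auto simp: dual_group_def simp del: add_0_left add_0_right)
  then show ?thesis by simp
qed

section \<open>Additivity and nonvanishing of the trace in characteristic 2\<close>

lemma power_two_power_add:
  fixes x y :: "'a::{field,finite}"
  assumes "CARD('a) = 2 ^ n"
  shows "(x + y) ^ (2 ^ i) = x ^ (2 ^ i) + y ^ (2 ^ i)"
proof (induction i)
  case (Suc i)
  have "(u + v)\<^sup>2 = u\<^sup>2 + v\<^sup>2" for u v :: 'a
  proof -
    have "(u + v)\<^sup>2 = u\<^sup>2 + v\<^sup>2 + (u * v + u * v)"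
      by (simp add: power2_eq_square algebra_simps)
    then show ?thesis
      by (simp add: add_self_eq_0_of_card[OF assms])
  qed
  then show ?case
    by (simp only: power_Suc2 power_mult Suc)
qed simp

lemma abs_trace_add:
  fixes x y :: "'a::{field,finite}"
  assumes "CARD('a) = 2 ^ n"
  shows "abs_trace m (x + y) = abs_trace m x + abs_trace m y"
  by (simp add: abs_trace_def power_two_power_add[OF assms] sum.distrib)

text \<open>As a polynomial the trace has degree less than the size of the field.\<close>

lemma abs_trace_nonzero:
  assumes "CARD('a::{field,finite}) = 2 ^ n"
  obtains x :: "'a::{field,finite}" where "abs_trace n x \<noteq> 0"
proof -
  \<comment> \<open>This rules out \<open>n = 0\<close>, where the trace would be an empty
    sum.\<close>
  have "CARD('a) \<noteq> 1"
    by (metis UNIV_I card_1_singletonE singletonD zero_neq_one)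
  then obtain m where n: "n = Suc m"
    using assms by (cases n) auto
  define p :: "'a poly" where "p = (\<Sum>i<n. monom 1 (2 ^ i))"
  have poly_p: "poly p x = abs_trace n x" for x
    by (simp add: p_def abs_trace_def poly_sum poly_monom)
  \<comment> \<open>Among the exponents \<open>2 ^ i\<close> only \<open>i = 0\<close> gives 1, so
    the linear coefficient witnesses that \<open>p\<close> is nonzero.\<close>
  have "coeff p 1 = (\<Sum>i<n. if i = 0 then 1 else 0)"
    unfolding p_def coeff_sum by (rule sum.cong) auto
  also have "\<dots> = 1"
    using n by (simp del: sum.lessThan_Suc)
  finally have "p \<noteq> 0"
    by auto
  then have "card {x. poly p x = 0} \<le> degree p"
    by (rule card_poly_roots_bound)
  also have "degree p \<le> 2 ^ m"
    unfolding p_def n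
    by (intro degree_sum_le) (auto intro!: order.trans[OF degree_monom_le] power_increasing)
  also have "\<dots> < CARD('a)"
    using assms n by simp
  finally have "{x. poly p x = 0} \<noteq> UNIV"
    by auto
  then show thesis
    using that poly_p by auto
qed

text \<open>Traces lie in \<open>{0, 1}\<close>, where 1 + 1 = 0 matches (-1) * (-1) = 1.\<close>

lemma minus_one_pow_abs_trace_add:
  fixes x y :: "'a::{field,finite}"
  assumes "CARD('a) = 2 ^ n"
  shows "minus_one_pow (abs_trace n (x + y)) =
    minus_one_pow (abs_trace n x) * minus_one_pow (abs_trace n y)"
  using abs_trace_in_prime_field[OF assms, of x] abs_trace_in_prime_field[OF assms, of y]
    add_self_eq_0_of_card[OF assms, of 1]
  by (auto simp: abs_trace_add[OF assms] minus_one_pow_def)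

section \<open>The trace pairing and its isomorphism onto the dual group\<close>

lemma trace_pairing_commute: "trace_pairing n g h = trace_pairing n h g"
  by (simp add: trace_pairing_def case_prod_beta mult.commute)

lemma trace_pairing_square: "trace_pairing n g h * trace_pairing n g h = 1"
  by (simp add: trace_pairing_def case_prod_beta minus_one_pow_def)

context
  fixes n :: nat
  assumes card: "CARD('a::{field,finite}) = 2 ^ n"
begin

lemma trace_pairing_add_right:
  fixes g h k :: "'a \<times> 'a"
  shows "trace_pairing n g (h + k) = trace_pairing n g h * trace_pairing n g k"
  by (simp add: trace_pairing_def case_prod_beta distrib_left
      minus_one_pow_abs_trace_add[OF card])

lemma trace_pairing_add_left:
  fixes g h k :: "'a \<times> 'a"
  shows "trace_pairing n (g + h) k = trace_pairing n g k * trace_pairing n h k"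
  by (metis trace_pairing_add_right trace_pairing_commute)

lemma trace_pairing_in_dual_group: "trace_pairing n (g :: 'a \<times> 'a) \<in> dual_group"
proof -
  have "trace_pairing n g h \<noteq> 0" for h
    using trace_pairing_square[of n g h] by auto
  then show ?thesis
    unfolding dual_group_def using trace_pairing_add_right[of g] by blast
qed

lemma trace_pairing_nondegenerate:
  fixes g :: "'a \<times> 'a"
  assumes "g \<noteq> 0"
  shows "trace_pairing n g \<noteq> (\<lambda>_. 1)"
proof -
  obtain x :: 'a where x: "abs_trace n x \<noteq> 0"
    using abs_trace_nonzero[OF card] .
  obtain a b where g: "g = (a, b)" by force
  \<comment> \<open>Dividing by a nonzero coordinate of \<open>g\<close> makes the argument of the
    trace equal to \<open>x\<close>, so the pairing takes the value -1.\<close>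
  have "trace_pairing n g (x / a, 0) \<noteq> 1" if "a \<noteq> 0"
    using x that by (simp add: g trace_pairing_def minus_one_pow_def)
  moreover have "trace_pairing n g (0, x / b) \<noteq> 1" if "b \<noteq> 0"
    using x that by (simp add: g trace_pairing_def minus_one_pow_def)
  ultimately show ?thesis
    using assms g by (auto simp: zero_prod_def)
qed

lemma diff_eq_add_of_card: "g - h = g + (h :: 'a \<times> 'a)"
  by (simp add: prod_eq_iff diff_eq_eq add.assoc add_self_eq_0_of_card[OF card])

text \<open>Turns the quotients in \<open>char_weight\<close> into differences in the group:
  subtraction is addition, and the values 1 and -1 are their own inverses.\<close>

lemma trace_pairing_diff:
  fixes g h :: "'a \<times> 'a"
  shows "trace_pairing n (g - h) = (\<lambda>k. trace_pairing n g k * inverse (trace_pairing n h k))"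
  by (simp add: fun_eq_iff diff_eq_add_of_card trace_pairing_add_left
      inverse_unique[OF trace_pairing_square])

lemma inj_trace_pairing: "inj (trace_pairing n :: 'a \<times> 'a \<Rightarrow> _)"
proof (rule injI)
  fix g h :: "'a \<times> 'a"
  assume "trace_pairing n g = trace_pairing n h"
  then have "trace_pairing n (g - h) = (\<lambda>_. 1)"
    by (simp add: fun_eq_iff diff_eq_add_of_card trace_pairing_add_left trace_pairing_square)
  then show "g = h"
    using trace_pairing_nondegenerate[of "g - h"] by auto
qed

text \<open>A character \<open>\<chi>\<close> outside the image would be orthogonal to all \<open>\<Delta>(g)\<close>; summing these
  relations over \<open>g\<close> leaves \<open>|G| \<chi>(0) = 0\<close>.\<close>

lemma dual_group_eq_range_trace_pairing:
  "dual_group = range (trace_pairing n :: 'a \<times> 'a \<Rightarrow> _)"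
proof (intro equalityI subsetI)
  fix \<chi> :: "'a \<times> 'a \<Rightarrow> complex"
  assume \<chi>: "\<chi> \<in> dual_group"
  show "\<chi> \<in> range (trace_pairing n)"
  proof (rule ccontr)
    assume no: "\<chi> \<notin> range (trace_pairing n)"
    have orth: "(\<Sum>h\<in>UNIV. \<chi> h * trace_pairing n g h) = 0" for g
    proof (rule sum_dual_group_eq_0)
      show "(\<lambda>h. \<chi> h * trace_pairing n g h) \<in> dual_group"
        using \<chi> trace_pairing_in_dual_group[of g] by (simp add: dual_group_def)
      show "(\<lambda>h. \<chi> h * trace_pairing n g h) \<noteq> (\<lambda>_. 1)"
      proof
        assume eq: "(\<lambda>h. \<chi> h * trace_pairing n g h) = (\<lambda>_. 1)"
        \<comment> \<open>Multiplying \<open>eq\<close> by the pairing, whose square is 1, would put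
          \<open>\<chi>\<close> in the image.\<close>
        have "\<chi> h = trace_pairing n g h" for h
        proof -
          have "\<chi> h = \<chi> h * trace_pairing n g h * trace_pairing n g h"
            by (simp add: mult.assoc trace_pairing_square)
          then show ?thesis
            using fun_cong[OF eq, of h] by simp
        qed
        then show False using no by blast
      qed
    qed
    \<comment> \<open>The dual orthogonality relation, over the first argument; symmetry of the
      pairing makes it a character sum.\<close>
    have inner: "(\<Sum>g\<in>UNIV. trace_pairing n g h) =
        (if h = 0 then of_nat CARD('a \<times> 'a) else 0)" for h :: "'a \<times> 'a"
    proof (cases "h = 0")
      case True
      then show ?thesis
        by (simp add: dual_group_0[OF trace_pairing_in_dual_group])
    next
      case False
      then show ?thesis
        using sum_dual_group_eq_0[OF trace_pairing_in_dual_group trace_pairing_nondegenerate]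
        by (simp add: trace_pairing_commute[of n _ h])
    qed
    have "0 = (\<Sum>g\<in>UNIV. \<Sum>h\<in>UNIV. \<chi> h * trace_pairing n g h)"
      by (simp add: orth)
    also have "\<dots> = (\<Sum>h\<in>UNIV. \<chi> h * (\<Sum>g\<in>UNIV. trace_pairing n g h))"
      by (subst sum.swap) (simp add: sum_distrib_left)
    also have "\<dots> = (\<Sum>h\<in>UNIV. if h = 0 then \<chi> h * of_nat CARD('a \<times> 'a) else 0)"
      by (rule sum.cong) (simp_all only: inner mult_zero_right if_distrib[of "(*) _"])
    also have "\<dots> = of_nat CARD('a \<times> 'a)"
      by (simp add: dual_group_0[OF \<chi>])
    finally show False by simp
  qed
qed (use trace_pairing_in_dual_group in auto)

section \<open>Weights and character sums for the graph\<close>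

lemma char_weight_trace_pairing:
  fixes g :: "'a \<times> 'a"
  shows "char_weight (trace_pairing n ` S) (trace_pairing n g) =
    card {(s, t). s \<in> S \<and> t \<in> S \<and> s - t = g}"
proof -
  let ?d = "trace_pairing n :: 'a \<times> 'a \<Rightarrow> _"
  have "{(\<phi>, \<psi>). \<phi> \<in> ?d ` S \<and> \<psi> \<in> ?d ` S \<and> (\<lambda>k. \<phi> k * inverse (\<psi> k)) = ?d g} =
      map_prod ?d ?d ` {(s, t). s \<in> S \<and> t \<in> S \<and> s - t = g}"
    using inj_trace_pairing
    by (auto simp: trace_pairing_diff[symmetric] inj_eq image_iff)
  moreover have "inj (map_prod ?d ?d)"
    using inj_trace_pairing by (simp add: prod.inj_map)
  ultimately show ?thesis
    unfolding char_weight_def by (simp add: card_image inj_on_subset)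
qed

lemma card_graph_differences:
  fixes F :: "'a \<Rightarrow> 'a"
  defines "S \<equiv> {(x, F x) | x. x \<in> UNIV}"
  shows "card {(s, t). s \<in> S \<and> t \<in> S \<and> s - t = (a, b)} = diff_count F a b"
proof -
  have minus: "u - v = u + v" for u v :: 'a
    by (simp add: diff_eq_eq add.assoc add_self_eq_0_of_card[OF card])
  \<comment> \<open>The abscissa \<open>x\<close> of the second point determines the pair, the first
    point having abscissa \<open>x + a\<close>; the second coordinates then give the condition on
    \<open>F\<close>.\<close>
  have "bij_betw (\<lambda>x. ((x + a, F (x + a)), (x, F x))) {x. F (x + a) + F x = b}
      {(s, t). s \<in> S \<and> t \<in> S \<and> s - t = (a, b)}"
    unfolding bij_betw_def
  proof
    show "inj_on (\<lambda>x. ((x + a, F (x + a)), (x, F x))) {x. F (x + a) + F x = b}"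
      by (auto simp: inj_on_def)
    have "x + y = c \<longleftrightarrow> x = y + c" for x y c :: 'a
      by (metis minus diff_eq_eq add.commute)
    then show "(\<lambda>x. ((x + a, F (x + a)), (x, F x))) ` {x. F (x + a) + F x = b} =
        {(s, t). s \<in> S \<and> t \<in> S \<and> s - t = (a, b)}"
      unfolding S_def
      using add_self_eq_0_of_card[OF card, of 1] by (auto simp: minus image_iff)
  qed
  then show ?thesis
    by (simp add: diff_count_def bij_betw_same_card)
qed

lemma char_sum_trace_pairing_graph:
  fixes F :: "'a \<Rightarrow> 'a"
  shows "char_sum (trace_pairing n (a, b)) {(x, F x) | x. x \<in> UNIV} = of_int (walsh n F a b)"
proof -
  have "{(x, F x) | x. x \<in> UNIV} = (\<lambda>x. (x, F x)) ` UNIV" by auto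
  then show ?thesis
    by (simp add: char_sum_def walsh_def sum.reindex inj_on_def trace_pairing_def add.commute)
qed

end

theorem theorem6p3:
  fixes F :: "'a::{field,finite} \<Rightarrow> 'a" and n :: nat
  assumes "CARD('a) = 2 ^ n"
  shows "formally_self_dual (trace_pairing n) {(x, F x) | x. x \<in> UNIV} \<longleftrightarrow>
    (\<forall>a b. 2 ^ n * int (diff_count F a b) = (walsh n F a b)\<^sup>2)"
proof -
  let ?S = "{(x, F x) | x. x \<in> UNIV}"
  have "?S = (\<lambda>x. (x, F x)) ` UNIV" by auto
  then have card_S: "card ?S = 2 ^ n"
    by (simp add: card_image inj_on_def assms)
  then have card_image_S: "card (trace_pairing n ` ?S) = 2 ^ n"
    by (subst card_image) (auto intro: inj_on_subset[OF inj_trace_pairing[OF assms]])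
  have "(cmod (char_sum (trace_pairing n (a, b)) ?S))\<^sup>2 =
      (real (card ?S))\<^sup>2 / real (card (trace_pairing n ` ?S)) *
        real (char_weight (trace_pairing n ` ?S) (trace_pairing n (a, b))) \<longleftrightarrow>
      2 ^ n * int (diff_count F a b) = (walsh n F a b)\<^sup>2" for a b
  proof -
    \<comment> \<open>Injectivity gives both sets size \<open>2 ^ n\<close>, so the factor collapses
      to \<open>2 ^ n\<close>.\<close>
    have "(real (card ?S))\<^sup>2 / real (card (trace_pairing n ` ?S)) *
        real (char_weight (trace_pairing n ` ?S) (trace_pairing n (a, b))) =
        of_int (2 ^ n * int (diff_count F a b))"
      unfolding card_S card_image_S char_weight_trace_pairing[OF assms]
        card_graph_differences[OF assms]
      by (simp add: power2_eq_square)
    \<comment> \<open>The character sum is an integer, so its squared modulus is its square.\<close>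
    moreover have "(cmod (char_sum (trace_pairing n (a, b)) ?S))\<^sup>2 =
        of_int ((walsh n F a b)\<^sup>2)"
      unfolding char_sum_trace_pairing_graph[OF assms] by simp
    ultimately show ?thesis
      by (metis of_int_eq_iff)
  qed
  \<comment> \<open>As the dual group is the range of the pairing, quantifying over characters means
    quantifying over \<open>(a, b)\<close>.\<close>
  then show ?thesis
    unfolding formally_self_dual_def formally_dual_pair_def
      dual_group_eq_range_trace_pairing[OF assms]
    by (simp add: image_mono)
qed

end
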